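(* Let $G$ be a finite simple graph on $n = |V(G)| \geq 3$ vertices, and let $r$ be an integer with $n-2 \leq r \leq n-1$. Then the $r$-independence complex $\mathrm{Ind}_r(G)$ is shellable.
   Context: For a graph $G$ and integer $r \geq 1$, a subset $A \subseteq V(G)$ is $r$-independent if every connected component of the induced subgraph $G[A]$ has at most $r$ vertices. The $r$-independence complex $\mathrm{Ind}_r(G)$ is the simplicial complex on $V(G)$ whose faces are the $r$-independent subsets of $V(G)$. A (not necessarily pure) simplicial complex $\Delta$ is shellable if its facets can be ordered $F_1, \dots, F_t$ so that for each $k > 1$ the complex $\langle F_k \rangle \cap \langle F_1, \dots, F_{k-1}\rangle$ is pure of dimension $\dim F_k - 1$, where $\langle \mathcal{F}\rangle$ denotes the simplicial complex generated by the sets in $\mathcal{F}$. *)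

theory Defs
  imports "Graph_Theory.Digraph" "Graph_Theory.Digraph_Component"
begin

text \<open>
  Finite simple graphs are the \<^locale>\<open>graph\<close>s of the AFP: finite, loop-free, symmetric
  digraphs without parallel arcs, where an edge is a pair of opposite arcs. By symmetry the
  strongly connected components \<^const>\<open>pre_digraph.sccs\<close> are the connected components.
\<close>

text \<open>
  As \<^const>\<open>card\<close> is 0 on infinite sets, this is meant for graphs with finitely many vertices.
\<close>

definition r_independent :: "('a, 'b) pre_digraph \<Rightarrow> nat \<Rightarrow> 'a set \<Rightarrow> bool" where
  "r_independent G r A \<longleftrightarrow>
     A \<subseteq> verts G \<and> (\<forall>C \<in> pre_digraph.sccs (G \<restriction> A). card (verts C) \<le> r)"

definition ind_complex :: "nat \<Rightarrow> ('a, 'b) pre_digraph \<Rightarrow> 'a set set" where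
  "ind_complex r G = {A. r_independent G r A}"

text \<open>
  An abstract simplicial complex is given by its set of faces, the empty face included.
\<close>

definition abstract_complex :: "'a set \<Rightarrow> 'a set set \<Rightarrow> bool" where
  "abstract_complex V \<Delta> \<longleftrightarrow>
     {} \<in> \<Delta> \<and> (\<forall>\<sigma>\<in>\<Delta>. finite \<sigma> \<and> \<sigma> \<subseteq> V) \<and> (\<forall>\<sigma>\<in>\<Delta>. \<forall>\<tau>. \<tau> \<subseteq> \<sigma> \<longrightarrow> \<tau> \<in> \<Delta>)"

definition facets :: "'a set set \<Rightarrow> 'a set set" where
  "facets \<Delta> = {F \<in> \<Delta>. \<forall>\<sigma>\<in>\<Delta>. F \<subseteq> \<sigma> \<longrightarrow> \<sigma> = F}"

definition generated_complex :: "'a set set \<Rightarrow> 'a set set" where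
  "generated_complex \<F> = {\<sigma>. \<exists>F\<in>\<F>. \<sigma> \<subseteq> F}"

text \<open>
  Integer-valued, so that the empty face has dimension -1; the complex whose only face is the
  empty one is therefore pure of dimension -1.
\<close>

definition face_dim :: "'a set \<Rightarrow> int" where
  "face_dim \<sigma> = int (card \<sigma>) - 1"

definition pure_of_dim :: "'a set set \<Rightarrow> int \<Rightarrow> bool" where
  "pure_of_dim \<Delta> d \<longleftrightarrow> \<Delta> \<noteq> {} \<and> (\<forall>F \<in> facets \<Delta>. face_dim F = d)"

definition shelling :: "'a set set \<Rightarrow> 'a set list \<Rightarrow> bool" where
  "shelling \<Delta> Fs \<longleftrightarrow> distinct Fs \<and> set Fs = facets \<Delta> \<and>
     (\<forall>k. 0 < k \<and> k < length Fs \<longrightarrow>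
        pure_of_dim (generated_complex {Fs ! k} \<inter> generated_complex (set (take k Fs)))
          (face_dim (Fs ! k) - 1))"

definition shellable :: "'a set set \<Rightarrow> bool" where
  "shellable \<Delta> \<longleftrightarrow> (\<exists>Fs. shelling \<Delta> Fs)"

lemma abstract_complex_ind_complex:
  assumes "graph G"
  shows "abstract_complex (verts G) (ind_complex r G)"
proof -
  interpret graph G by fact
  have down: "r_independent G r B" if A: "r_independent G r A" and BA: "B \<subseteq> A" for A B
  proof -
    have AV: "A \<subseteq> verts G" using A by (simp add: r_independent_def)
    have fA: "finite A" using AV finite_verts by (rule finite_subset)
    interpret GA: wf_digraph "G \<restriction> A" by (rule wellformed_induce_subgraph)
    interpret GB: wf_digraph "G \<restriction> B" by (rule wellformed_induce_subgraph)
    have symA: "symmetric (G \<restriction> A)"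
      using sym_arcs induced_induce[OF AV] by (rule induced_graph_imp_symmetric)
    interpret SA: sym_digraph "G \<restriction> A" using symA by unfold_locales
    have "card (verts C) \<le> r" if C: "C \<in> pre_digraph.sccs (G \<restriction> B)" for C
    proof -
      have "verts C \<in> GB.sccs_verts" using C GB.sccs_verts_conv by blast
      then obtain u where u: "u \<in> verts C"
        and reach: "\<And>v. v \<in> verts C \<Longrightarrow> u \<rightarrow>\<^sup>*\<^bsub>G \<restriction> B\<^esub> v"
        unfolding GB.in_sccs_verts_conv_reachable by blast
      have reachA: "u \<rightarrow>\<^sup>*\<^bsub>G \<restriction> A\<^esub> v" if "v \<in> verts C" for v
        using reachable_induce_ss[OF reach[OF that] BA] .
      let ?K = "{v. u \<rightarrow>\<^sup>*\<^bsub>G \<restriction> A\<^esub> v}"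
      have uA: "u \<in> verts (G \<restriction> A)" using reachA[OF u] by (rule GA.reachable_in_verts)
      have "((G \<restriction> A) \<restriction> ?K) \<in> GA.sccs" using uA by (rule SA.induce_reachable_is_in_sccs)
      then have "card (verts ((G \<restriction> A) \<restriction> ?K)) \<le> r"
        using A unfolding r_independent_def by blast
      then have "card ?K \<le> r" by simp
      moreover have "?K \<subseteq> A"
        using GA.reachable_in_verts(2) by fastforce
      then have "finite ?K" using fA by (rule finite_subset)
      then have "card (verts C) \<le> card ?K"
        by (rule card_mono) (use reachA in blast)
      ultimately show ?thesis by simp
    qed
    moreover have "B \<subseteq> verts G" using AV BA by (rule subset_trans[rotated])
    ultimately show ?thesis unfolding r_independent_def by blast
  qed
  have "C \<notin> pre_digraph.sccs (G \<restriction> {})" for C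
    by (simp add: pre_digraph.sccs_def strongly_connected_def induced_subgraph_def subgraph_def)
  then have "r_independent G r {}" unfolding r_independent_def by blast
  moreover have "finite A \<and> A \<subseteq> verts G" if "r_independent G r A" for A
    using that finite_subset[OF _ finite_verts] unfolding r_independent_def by blast
  ultimately show ?thesis
    unfolding abstract_complex_def ind_complex_def using down by blast
qed

end

theory Submission
  imports Defs
begin

text \<open>
  As soon as \<open>n - 2 \<le> r\<close>, every set omitting at least two vertices is a face, so a facet other than
  the full vertex set \<open>V\<close> has the form \<open>V - {v}\<close> or \<open>V - {u, v}\<close>. List the facets \<open>V - {v}\<close> first, then
  the facets \<open>V - {u, v}\<close> by increasing \<open>e u + e v\<close> for an arbitrary numbering \<open>e\<close> of the vertices. If
  \<open>V - {w, z}\<close> comes before \<open>V - {u, v}\<close> and the two pairs are disjoint, then a vertex of \<open>{u, v}\<close> can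
  be exchanged for a smaller one of \<open>{w, z}\<close>, which gives an earlier facet meeting \<open>V - {u, v}\<close> in
  codimension one.
\<close>

text \<open>
  The rank need not be injective: facets of equal rank may be listed in any order.
\<close>

lemma shellable_if_ranked:
  fixes rank :: "'a set \<Rightarrow> nat"
  assumes fin: "finite (facets \<Delta>)"
    and fin_facet: "\<And>F. F \<in> facets \<Delta> \<Longrightarrow> finite F"
    and exchange: "\<And>F F'. \<lbrakk>F \<in> facets \<Delta>; F' \<in> facets \<Delta>; F' \<noteq> F; rank F' \<le> rank F\<rbrakk> \<Longrightarrow>
      \<exists>F''\<in>facets \<Delta>. \<exists>x\<in>F - F'. F \<inter> F'' = F - {x} \<and> (F'' = F' \<or> rank F'' < rank F)"
  shows "shellable \<Delta>"
proof -
  obtain xs where xs: "set xs = facets \<Delta>" "distinct xs"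
    using finite_distinct_list[OF fin] by blast
  define Fs where "Fs = sort_key rank xs"
  have set_Fs: "set Fs = facets \<Delta>" and dist: "distinct Fs"
    and sorted: "sorted (map rank Fs)"
    using xs by (simp_all add: Fs_def)
  have mono: "rank (Fs ! i) \<le> rank (Fs ! j)" if "i \<le> j" "j < length Fs" for i j
    using sorted_nth_mono[OF sorted, of i j] that by simp
  have "pure_of_dim (generated_complex {Fs ! k} \<inter> generated_complex (set (take k Fs)))
      (face_dim (Fs ! k) - 1)" (is "pure_of_dim ?I _")
    if k: "0 < k" "k < length Fs" for k
  proof -
    define F where "F = Fs ! k"
    have F: "F \<in> facets \<Delta>" using k set_Fs by (auto simp: F_def)
    have take_iff: "A \<in> set (take k Fs) \<longleftrightarrow> (\<exists>i<k. A = Fs ! i)" for A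
      using k by (auto simp: in_set_conv_nth)
    have "{} \<in> ?I" using k take_iff by (auto simp: generated_complex_def)
    \<comment> \<open>A facet \<open>\<sigma>\<close> of the intersection lies in \<open>F\<close>
      and in some earlier \<open>Fs ! i\<close>. The exchange gives a face \<open>F - {x}\<close> of
      the intersection that contains \<open>\<sigma>\<close>, so the two coincide by
      maximality.\<close>
    moreover have "face_dim \<sigma> = face_dim F - 1" if \<sigma>: "\<sigma> \<in> facets ?I" for \<sigma>
    proof -
      from \<sigma> obtain i where i: "i < k" "\<sigma> \<subseteq> F" "\<sigma> \<subseteq> Fs ! i"
        by (auto simp: facets_def generated_complex_def take_iff F_def)
      have "Fs ! i \<in> facets \<Delta>" using i k set_Fs by (auto simp flip: set_Fs)
      moreover have "Fs ! i \<noteq> F"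
        using i k dist by (simp add: F_def nth_eq_iff_index_eq)
      moreover have "rank (Fs ! i) \<le> rank F" using mono[of i k] i k by (simp add: F_def)
      ultimately obtain F'' x where F'': "F'' \<in> facets \<Delta>" "F \<inter> F'' = F - {x}"
          "F'' = Fs ! i \<or> rank F'' < rank F" and x: "x \<in> F" "x \<notin> Fs ! i"
        using exchange[OF F] by blast
      obtain j where j: "j < length Fs" "F'' = Fs ! j"
        using F''(1) by (metis set_Fs in_set_conv_nth)
      have "F'' \<in> set (take k Fs)"
        using F''(3)
      proof
        \<comment> \<open>Strictness matters here: only a strictly smaller rank forces a position
          before \<open>k\<close>.\<close>
        assume "rank F'' < rank F"
        then have "j < k" using mono[of k j] j by (force simp: F_def not_less)
        then show ?thesis using j take_iff by blast
      qed (use i take_iff in blast)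
      then have "F - {x} \<in> ?I"
        using F''(2) by (auto simp: generated_complex_def F_def)
      moreover have "\<sigma> \<subseteq> F - {x}" using i x by blast
      ultimately have "\<sigma> = F - {x}" using \<sigma> by (auto simp: facets_def)
      moreover have "card F > 0" using x fin_facet[OF F] by (auto simp: card_gt_0_iff)
      ultimately show ?thesis using x by (simp add: face_dim_def)
    qed
    ultimately show ?thesis by (auto simp: pure_of_dim_def F_def)
  qed
  then show ?thesis using dist set_Fs by (auto simp: shellable_def shelling_def)
qed

text \<open>Isolates the argument from graphs: the \<open>skeleton\<close> hypothesis is all that is
  used of them beyond having a complex on a finite set.\<close>

lemma shellable_if_codim2_skeleton:
  assumes complex: "abstract_complex V \<Delta>" and fin: "finite V"
    and skeleton: "\<And>A. \<lbrakk>A \<subseteq> V; card A + 2 \<le> card V\<rbrakk> \<Longrightarrow> A \<in> \<Delta>"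
  shows "shellable \<Delta>"
proof -
  have sub: "\<sigma> \<subseteq> V" if "\<sigma> \<in> \<Delta>" for \<sigma>
    using complex that by (auto simp: abstract_complex_def)
  have down: "\<tau> \<in> \<Delta>" if "\<sigma> \<in> \<Delta>" "\<tau> \<subseteq> \<sigma>" for \<sigma> \<tau>
    using complex that unfolding abstract_complex_def by blast
  have facet_sub: "F \<subseteq> V" if "F \<in> facets \<Delta>" for F
    using that sub by (auto simp: facets_def)
  have fin_facets: "finite (facets \<Delta>)"
    by (rule finite_subset[of _ "Pow V"]) (use facet_sub fin in auto)
  have fin_facet: "finite F" if "F \<in> facets \<Delta>" for F
    using facet_sub[OF that] fin by (rule finite_subset)
  show ?thesis
  proof (cases "V \<in> \<Delta>")
    case True
    have eq: "F = V" if "F \<in> facets \<Delta>" for F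
      using that True facet_sub[OF that] unfolding facets_def by blast
    show ?thesis
    proof (rule shellable_if_ranked[OF fin_facets fin_facet])
      fix F F'
      assume "F \<in> facets \<Delta>" "F' \<in> facets \<Delta>" "F' \<noteq> F"
      then have False using eq by metis
      \<comment> \<open>\<open>V\<close> is the only facet, so the condition is vacuous;
        \<open>0 < 0\<close> fixes the rank as constantly zero.\<close>
      then show "\<exists>F''\<in>facets \<Delta>. \<exists>x\<in>F - F'. F \<inter> F'' = F - {x} \<and> (F'' = F' \<or> (0::nat) < 0)"
        by blast
    qed
  next
    case V: False
    have pair_face: "V - {u, v} \<in> \<Delta>" if "u \<in> V" "v \<in> V" "u \<noteq> v" for u v
    proof (rule skeleton)
      have "card (V - {u, v}) = card V - 2" using that fin by (simp add: card_Diff_subset)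
      moreover have "card {u, v} \<le> card V" using that fin by (intro card_mono) auto
      ultimately show "card (V - {u, v}) + 2 \<le> card V" using that by simp
    qed simp
    \<comment> \<open>The condition splits into one on \<open>u\<close> and one on \<open>v\<close>,
      so pairs taken from different facets can be recombined into new facets.\<close>
    have pair_facet_iff: "V - {u, v} \<in> facets \<Delta> \<longleftrightarrow> V - {u} \<notin> \<Delta> \<and> V - {v} \<notin> \<Delta>"
      if uv: "u \<in> V" "v \<in> V" "u \<noteq> v" for u v
    proof
      assume "V - {u, v} \<in> facets \<Delta>"
      then have "\<sigma> = V - {u, v}" if "\<sigma> \<in> \<Delta>" "V - {u, v} \<subseteq> \<sigma>" for \<sigma>
        using that by (auto simp: facets_def)
      from this[of "V - {u}"] this[of "V - {v}"] show "V - {u} \<notin> \<Delta> \<and> V - {v} \<notin> \<Delta>"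
        using uv by blast
    next
      assume *: "V - {u} \<notin> \<Delta> \<and> V - {v} \<notin> \<Delta>"
      have "\<sigma> = V - {u, v}" if \<sigma>: "\<sigma> \<in> \<Delta>" "V - {u, v} \<subseteq> \<sigma>" for \<sigma>
      proof -
        have "u \<notin> \<sigma>" using \<sigma> * down[of \<sigma> "V - {v}"] by blast
        moreover have "v \<notin> \<sigma>" using \<sigma> * down[of \<sigma> "V - {u}"] by blast
        ultimately show ?thesis using \<sigma> sub by blast
      qed
      then show "V - {u, v} \<in> facets \<Delta>" using pair_face[OF uv] by (simp add: facets_def)
    qed
    have facet_cases: "(\<exists>v\<in>V. F = V - {v}) \<or> (\<exists>u\<in>V. \<exists>v\<in>V. u \<noteq> v \<and> F = V - {u, v})"
      if F: "F \<in> facets \<Delta>" for F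
    proof -
      have "F \<subseteq> V" "F \<noteq> V" using F V facet_sub by (auto simp: facets_def)
      then obtain v where v: "v \<in> V" "v \<notin> F" by blast
      show ?thesis
      proof (cases "F = V - {v}")
        case False
        then obtain u where u: "u \<in> V" "u \<notin> F" "u \<noteq> v" using v \<open>F \<subseteq> V\<close> by blast
        have "F \<subseteq> V - {u, v}" using u v \<open>F \<subseteq> V\<close> by blast
        then have "F = V - {u, v}" using F pair_face[of u v] u v by (auto simp: facets_def)
        then show ?thesis using u v by blast
      qed (use v in blast)
    qed
    obtain e :: "'a \<Rightarrow> nat" where inj: "inj_on e V"
      using finite_imp_inj_to_nat_seg[OF fin] by blast
    \<comment> \<open>The value 0 puts the facets \<open>V - {v}\<close> first. By injectivity of
      \<open>e\<close>, every facet omitting two vertices has positive rank.\<close>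
    define rank where "rank F = (if card (V - F) = 1 then 0 else sum e (V - F))" for F
    have rank1: "rank (V - {v}) = 0" if "v \<in> V" for v
      using that by (simp add: rank_def double_diff)
    have rank2: "rank (V - {u, v}) = e u + e v" if "u \<in> V" "v \<in> V" "u \<noteq> v" for u v
      using that by (simp add: rank_def double_diff)
    show ?thesis
    proof (rule shellable_if_ranked[where rank = rank, OF fin_facets fin_facet])
      fix F F'
      assume F: "F \<in> facets \<Delta>" and F': "F' \<in> facets \<Delta>" and ne: "F' \<noteq> F"
        and le: "rank F' \<le> rank F"
      have nsub: "\<not> F \<subseteq> F'" using F F' ne by (auto simp: facets_def)
      let ?goal = "\<exists>F''\<in>facets \<Delta>. \<exists>x\<in>F - F'. F \<inter> F'' = F - {x} \<and> (F'' = F' \<or> rank F'' < rank F)"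
      have direct: ?goal if "x \<in> F - F'" "F \<inter> F' = F - {x}" for x
        using that F' by blast
      from facet_cases[OF F'] show ?goal
      proof (elim disjE bexE conjE)
        \<comment> \<open>Distinct facets are incomparable, so \<open>w\<close> lies in
          \<open>F\<close> and \<open>F'\<close> itself meets \<open>F\<close> in
          \<open>F - {w}\<close>.\<close>
        fix w assume "w \<in> V" "F' = V - {w}"
        then show ?thesis using nsub facet_sub[OF F] by (intro direct[of w]) auto
      next
        fix w z assume wz: "w \<in> V" "z \<in> V" "w \<noteq> z" "F' = V - {w, z}"
        from facet_cases[OF F] show ?thesis
        proof (elim disjE bexE conjE)
          fix v assume "v \<in> V" "F = V - {v}"
          \<comment> \<open>Here \<open>rank F\<close> is 0, so both \<open>e w\<close> and
            \<open>e z\<close> would have to vanish.\<close>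
          then have "e w = e z" using le wz rank1 rank2 by simp
          then show ?thesis using wz inj by (auto dest: inj_onD)
        next
          fix u v assume uv: "u \<in> V" "v \<in> V" "u \<noteq> v" "F = V - {u, v}"
          have single: "V - {y} \<notin> \<Delta>" if "y \<in> {u, v, w, z}" for y
            using that F F' uv wz pair_facet_iff by auto
          \<comment> \<open>Replacing the omitted vertex \<open>p\<close> by \<open>x\<close> lowers
            the rank and keeps \<open>q\<close> omitted. The new set is a facet since neither
            \<open>V - {x}\<close> nor \<open>V - {q}\<close> is a face.\<close>
          have swap: ?goal if "{p, q} = {u, v}" "{x, y} = {w, z}" "x \<notin> {u, v}" "e x < e p" for p q x y
          proof -
            have *: "x \<in> V" "q \<in> V" "x \<noteq> q" "p \<in> V" "p \<noteq> q" "x \<noteq> p" "F = V - {p, q}"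
                "x \<in> F - F'" "x \<in> {w, z}" "q \<in> {u, v}"
              using that uv wz by (auto simp: doubleton_eq_iff)
            have "V - {x, q} \<in> facets \<Delta>"
              using * single[of x] single[of q] pair_facet_iff[of x q] by blast
            moreover have "F \<inter> (V - {x, q}) = F - {x}" using * by blast
            moreover have "rank (V - {x, q}) < rank F" using * rank2 that(4) by simp
            ultimately show ?thesis using *(8) by blast
          qed
          show ?thesis
          proof (cases "w \<in> {u, v} \<or> z \<in> {u, v}")
            case True
            \<comment> \<open>The pairs share exactly one vertex, so \<open>F'\<close> already meets
              \<open>F\<close> in codimension one.\<close>
            then show ?thesis
            proof
              assume "w \<in> {u, v}"
              then show ?thesis using uv wz ne by (intro direct[of z]) auto
            next
              assume "z \<in> {u, v}"
              then show ?thesis using uv wz ne by (intro direct[of w]) auto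
            qed
          next
            case False
            have "e w + e z \<le> e u + e v" using le uv wz rank2 by simp
            \<comment> \<open>This excludes the tie in which \<open>e w = e u\<close> and
              \<open>e z = e v\<close>; otherwise the sums could not compare this way without a drop
              in one coordinate.\<close>
            moreover have "e w \<noteq> e u"
              using False uv wz inj by (auto dest: inj_onD)
            ultimately have "e w < e u \<or> e z < e v" by linarith
            then show ?thesis
              using swap[of u v w z] swap[of v u z w] False by (auto simp: insert_commute)
          qed
        qed
      qed
    qed
  qed
qed

lemma r_independent_if_card_le:
  assumes "A \<subseteq> verts G" "finite A" "card A \<le> r"
  shows "r_independent G r A"
proof -
  have "card (verts C) \<le> r" if "C \<in> pre_digraph.sccs (G \<restriction> A)" for C
  proof -
    have "verts C \<subseteq> A"
      using that unfolding pre_digraph.sccs_def induced_subgraph_def subgraph_def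
      by simp
    then show ?thesis using card_mono[OF assms(2)] assms(3) by (meson le_trans)
  qed
  then show ?thesis using assms by (simp add: r_independent_def)
qed

theorem theorem4p4:
  fixes G :: "('a, 'b) pre_digraph" and r n :: nat
  assumes "graph G"
    and "n = card (verts G)" and "n \<ge> 3"
    and "n - 2 \<le> r" and "r \<le> n - 1"
  shows "shellable (ind_complex r G)"
proof -
  interpret graph G by fact
  show ?thesis
  proof (rule shellable_if_codim2_skeleton[OF abstract_complex_ind_complex[OF \<open>graph G\<close>] finite_verts])
    \<comment> \<open>Such a set has at most \<open>n - 2\<close>, hence at most \<open>r\<close>,
      vertices, so none of its components can exceed \<open>r\<close>.\<close>
    fix A assume "A \<subseteq> verts G" "card A + 2 \<le> card (verts G)"
    then show "A \<in> ind_complex r G"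
      using assms finite_subset[OF _ finite_verts]
      by (auto simp: ind_complex_def intro!: r_independent_if_card_le)
  qed
qed

end
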